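(* There is an absolute constant $C\ge 1$ such that for every instance of the linearly correlated prophet problem in which every entry of $A$ lies in $\{0,1\}$, there exists a threshold $\tau$ for which the fixed-threshold algorithm satisfies $\mathbb{E}[\mathrm{ALG}_\tau]\ge \frac{1}{C}\mathbb{E}[\max_i X_i]$.
   Context: Linearly correlated prophet problem: there are $m$ mutually independent nonnegative random variables $Y_1,\dots,Y_m$ with known distributions and a known matrix $A\in\mathbb{R}_{\ge 0}^{n\times m}$; the values are $X_i=\sum_j A_{ij}Y_j$, arriving one at a time. With $0/1$ entries, equivalently there are sets $S_1,\dots,S_n\subseteq\{1,\dots,m\}$ with $X_i=\sum_{j\in S_i}Y_j$. The fixed-threshold algorithm $\mathrm{ALG}_\tau$ stops at the first $X_i$ with $X_i\ge\tau$ and receives reward $X_i$ (reward $0$ if none); $\mathrm{ALG}_\tau$ also denotes this reward. *)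

theory Defs
  imports "HOL-Probability.Probability"
begin

text \<open>
  An instance is given by the distributions \<open>D j\<close> of the mutually independent variables
  \<open>Y\<^sub>j\<close> (\<open>j < m\<close>) and an \<open>n \<times> m\<close> matrix \<open>A\<close>, of which only the entries
  \<open>A i j\<close> with \<open>i < n\<close> and \<open>j < m\<close> matter. The values arrive in the order of the row index, so
  all arrival orders are covered by permuting rows.
\<close>

definition linear_prophet_instance ::
    "nat \<Rightarrow> nat \<Rightarrow> (nat \<Rightarrow> nat \<Rightarrow> real) \<Rightarrow> (nat \<Rightarrow> real measure) \<Rightarrow> bool" where
  "linear_prophet_instance n m A D \<longleftrightarrow>
     0 < n \<and>
     (\<forall>i<n. \<forall>j<m. 0 \<le> A i j) \<and>
     (\<forall>j<m. prob_space (D j) \<and> sets (D j) = sets borel \<and> (AE y in D j. 0 \<le> y))"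

definition prophet_value :: "nat \<Rightarrow> (nat \<Rightarrow> nat \<Rightarrow> real) \<Rightarrow> (nat \<Rightarrow> real) \<Rightarrow> nat \<Rightarrow> real" where
  "prophet_value m A y i = (\<Sum>j<m. A i j * y j)"

definition threshold_reward :: "nat \<Rightarrow> real \<Rightarrow> (nat \<Rightarrow> real) \<Rightarrow> real" where
  "threshold_reward n \<tau> x =
     (if \<exists>i<n. \<tau> \<le> x i then x (LEAST i. i < n \<and> \<tau> \<le> x i) else 0)"

text \<open>
  Expectations are over the joint law of independent variables, the product measure; stating the
  problem on the product space keeps the constant of the theorem independent of the type
  underlying a sample space (see \<open>indep_vars_linear_prophet\<close> below for the passage to arbitrary
  probability spaces). They are nonnegative integrals with values in \<open>[0, \<infinity>]\<close>, since no
  finiteness of means is assumed.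
\<close>

definition expected_alg ::
    "nat \<Rightarrow> nat \<Rightarrow> (nat \<Rightarrow> nat \<Rightarrow> real) \<Rightarrow> (nat \<Rightarrow> real measure) \<Rightarrow> real \<Rightarrow> ennreal" where
  "expected_alg n m A D \<tau> =
     (\<integral>\<^sup>+ y. ennreal (threshold_reward n \<tau> (prophet_value m A y)) \<partial>(Pi\<^sub>M {..<m} D))"

definition expected_max ::
    "nat \<Rightarrow> nat \<Rightarrow> (nat \<Rightarrow> nat \<Rightarrow> real) \<Rightarrow> (nat \<Rightarrow> real measure) \<Rightarrow> ennreal" where
  "expected_max n m A D =
     (\<integral>\<^sup>+ y. ennreal (MAX i\<in>{..<n}. prophet_value m A y i) \<partial>(Pi\<^sub>M {..<m} D))"

lemma prophet_value_measurable:
  "(\<lambda>y. prophet_value m A y i) \<in> borel_measurable (Pi\<^sub>M {..<m} (\<lambda>_. borel))"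
  unfolding prophet_value_def by measurable

lemma threshold_reward_measurable:
  "(\<lambda>y. threshold_reward n \<tau> (prophet_value m A y)) \<in> borel_measurable (Pi\<^sub>M {..<m} (\<lambda>_. borel))"
proof -
  note [measurable] = prophet_value_measurable
  have "(\<lambda>y. \<Sum>k<n. if \<tau> \<le> prophet_value m A y k \<and> (\<forall>i<k. \<not> \<tau> \<le> prophet_value m A y i)
            then prophet_value m A y k else 0) \<in> borel_measurable (Pi\<^sub>M {..<m} (\<lambda>_. borel))"
    by measurable
  moreover have "threshold_reward n \<tau> x =
      (\<Sum>k<n. if \<tau> \<le> x k \<and> (\<forall>i<k. \<not> \<tau> \<le> x i) then x k else 0)" for x
  proof (cases "\<exists>i<n. \<tau> \<le> x i")
    case True
    define l where "l = (LEAST i. i < n \<and> \<tau> \<le> x i)"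
    have l: "l < n" "\<tau> \<le> x l"
      using LeastI_ex[of "\<lambda>i. i < n \<and> \<tau> \<le> x i"] True unfolding l_def by auto
    have less: "\<not> \<tau> \<le> x i" if "i < l" for i
      using not_less_Least[of i "\<lambda>i. i < n \<and> \<tau> \<le> x i"] that l unfolding l_def by auto
    have "(\<tau> \<le> x k \<and> (\<forall>i<k. \<not> \<tau> \<le> x i)) \<longleftrightarrow> k = l" for k
      using l less by (metis linorder_neqE_nat)
    then have "(\<Sum>k<n. if \<tau> \<le> x k \<and> (\<forall>i<k. \<not> \<tau> \<le> x i) then x k else 0) = x l"
      using l by simp
    then show ?thesis
      using True by (simp add: threshold_reward_def l_def)
  next
    case False
    then show ?thesis
      by (auto simp: threshold_reward_def intro!: sum.neutral[symmetric])
  qed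
  ultimately show ?thesis by simp
qed

lemma max_value_measurable:
  assumes "0 < n"
  shows "(\<lambda>y. MAX i\<in>{..<n}. prophet_value m A y i) \<in> borel_measurable (Pi\<^sub>M {..<m} (\<lambda>_. borel))"
  using assms by (intro borel_measurable_Max prophet_value_measurable) auto

lemma (in prob_space) distr_indep_vars_PiM:
  fixes Y :: "nat \<Rightarrow> 'a \<Rightarrow> real"
  assumes "indep_vars (\<lambda>_. borel) Y {..<m}"
    and [measurable]: "f \<in> borel_measurable (Pi\<^sub>M {..<m} (\<lambda>_. borel))"
  shows "(\<integral>\<^sup>+ y. f y \<partial>(Pi\<^sub>M {..<m} (\<lambda>j. distr M borel (Y j)))) =
         (\<integral>\<^sup>+ \<omega>. f (\<lambda>j\<in>{..<m}. Y j \<omega>) \<partial>M)"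
proof (cases "m = 0")
  case True
  then show ?thesis
    by (simp add: PiM_empty nn_integral_count_space_finite emeasure_space_1 restrict_def)
next
  case False
  have [measurable]: "\<And>j. j \<in> {..<m} \<Longrightarrow> Y j \<in> borel_measurable M"
    using assms by (auto simp: indep_vars_def)
  have "distr M (Pi\<^sub>M {..<m} (\<lambda>_. borel)) (\<lambda>\<omega>. \<lambda>j\<in>{..<m}. Y j \<omega>) =
        Pi\<^sub>M {..<m} (\<lambda>j. distr M borel (Y j))"
    using assms False by (subst indep_vars_iff_distr_eq_PiM'[symmetric]) auto
  then show ?thesis
    by (simp flip: \<open>_ = Pi\<^sub>M _ _\<close> add: nn_integral_distr)
qed

lemma (in prob_space) indep_vars_linear_prophet:
  fixes Y :: "nat \<Rightarrow> 'a \<Rightarrow> real"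
  assumes indep: "indep_vars (\<lambda>_. borel) Y {..<m}"
    and nonneg: "\<And>j. j < m \<Longrightarrow> AE \<omega> in M. 0 \<le> Y j \<omega>"
    and A: "\<And>i j. i < n \<Longrightarrow> j < m \<Longrightarrow> 0 \<le> A i j" and n: "0 < n"
  defines "D \<equiv> \<lambda>j. distr M borel (Y j)"
  defines "X \<equiv> \<lambda>i \<omega>. \<Sum>j<m. A i j * Y j \<omega>"
  shows "linear_prophet_instance n m A D"
    and "expected_alg n m A D \<tau> = (\<integral>\<^sup>+ \<omega>. ennreal (threshold_reward n \<tau> (\<lambda>i. X i \<omega>)) \<partial>M)"
    and "expected_max n m A D = (\<integral>\<^sup>+ \<omega>. ennreal (MAX i\<in>{..<n}. X i \<omega>) \<partial>M)"
proof -
  have Y: "\<And>j. j < m \<Longrightarrow> Y j \<in> borel_measurable M"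
    using indep by (auto simp: indep_vars_def)
  show "linear_prophet_instance n m A D"
    using Y A n nonneg
    by (auto simp: linear_prophet_instance_def D_def AE_distr_iff intro!: prob_space_distr)
  have X: "prophet_value m A (\<lambda>j\<in>{..<m}. Y j \<omega>) = (\<lambda>i. X i \<omega>)" for \<omega>
    by (auto simp: prophet_value_def X_def)
  show "expected_alg n m A D \<tau> = (\<integral>\<^sup>+ \<omega>. ennreal (threshold_reward n \<tau> (\<lambda>i. X i \<omega>)) \<partial>M)"
    unfolding expected_alg_def D_def
    by (subst distr_indep_vars_PiM[OF indep])
       (auto intro!: measurable_compose[OF threshold_reward_measurable] simp: X)
  show "expected_max n m A D = (\<integral>\<^sup>+ \<omega>. ennreal (MAX i\<in>{..<n}. X i \<omega>) \<partial>M)"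
    unfolding expected_max_def D_def
    by (subst distr_indep_vars_PiM[OF indep])
       (auto intro!: measurable_compose[OF max_value_measurable[OF n]] simp: X)
qed

end

theory Submission
  imports Defs
begin

text \<open>
  Fix \<open>t > 0\<close>, let \<open>M = max\<^sub>i X\<^sub>i\<close>, \<open>q = P(M < t)\<close>, and let \<open>B\<close> be the sum of \<open>E[Y\<^sub>j; Y\<^sub>j \<ge> t]\<close> over the
  columns \<open>j\<close> that occur in some row. The threshold \<open>t\<close> earns at least \<open>t (1 - q)\<close>. It also earns
  at least \<open>q B\<close>: the events that \<open>Y\<^sub>j \<ge> t\<close> while the maximum without \<open>Y\<^sub>j\<close> stays below \<open>t\<close> are
  disjoint, and on each of them the first \<open>X\<^sub>i\<close> to reach \<open>t\<close> must contain \<open>Y\<^sub>j\<close>.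
  Conversely \<open>E[M] \<le> E[M'] + B\<close>, where \<open>M'\<close> is the maximum after dropping the values \<open>Y\<^sub>j \<ge> t\<close>.
  Adding the truncated variables one at a time, a partial maximum that first reaches \<open>t\<close> is at
  most \<open>2 t\<close>, and what comes after is independent of the past; hence
  \<open>E[M'] \<le> 2 t + (1 - q) E[M']\<close>, so \<open>E[M'] \<le> 4 t\<close> when \<open>q \<ge> 1/2\<close>. Taking \<open>t = E[M] / 8\<close> gives
  \<open>C = 16\<close>; if \<open>E[M]\<close> is infinite, any \<open>t\<close> with \<open>q \<ge> 1/2\<close> has \<open>B\<close> infinite.
\<close>

section \<open>Independence of disjoint blocks of coordinates\<close>

text \<open>Fubini over the two blocks: once the foreign coordinates are frozen, the integrand is a
  product of a function of the first block and a function of the second.\<close>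

lemma (in product_prob_space) nn_integral_PiM_mult_indep:
  fixes f g :: "('i \<Rightarrow> 'a) \<Rightarrow> ennreal"
  assumes fin: "finite J" "finite K" and disj: "J \<inter> K = {}"
    and f: "f \<in> borel_measurable (Pi\<^sub>M (J \<union> K) M)"
    and g: "g \<in> borel_measurable (Pi\<^sub>M (J \<union> K) M)"
    and f_dep: "\<And>x y. (\<And>i. i \<in> J \<Longrightarrow> x i = y i) \<Longrightarrow> f x = f y"
    and g_dep: "\<And>x y. (\<And>i. i \<in> K \<Longrightarrow> x i = y i) \<Longrightarrow> g x = g y"
  shows "(\<integral>\<^sup>+ x. f x * g x \<partial>Pi\<^sub>M (J \<union> K) M) =
         (\<integral>\<^sup>+ x. f x \<partial>Pi\<^sub>M (J \<union> K) M) * (\<integral>\<^sup>+ x. g x \<partial>Pi\<^sub>M (J \<union> K) M)"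
proof -
  interpret J: prob_space "Pi\<^sub>M J M" by (intro prob_space_PiM M.prob_space_axioms)
  interpret K: prob_space "Pi\<^sub>M K M" by (intro prob_space_PiM M.prob_space_axioms)
  \<comment> \<open>Arbitrary reference points: by \<open>f_dep\<close> and \<open>g_dep\<close> the
    values of \<open>F\<close> and \<open>G\<close> do not depend on the choice.\<close>
  obtain x0 where x0: "x0 \<in> space (Pi\<^sub>M J M)" using J.not_empty by blast
  obtain y0 where y0: "y0 \<in> space (Pi\<^sub>M K M)" using K.not_empty by blast
  define F where "F x = f (merge J K (x, y0))" for x
  define G where "G y = g (merge J K (x0, y))" for y
  have F: "f (merge J K (x, y)) = F x" for x y
    unfolding F_def by (rule f_dep) (auto simp: merge_def)
  have G: "g (merge J K (x, y)) = G y" for x y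
    unfolding G_def using disj by (intro g_dep) (auto simp: merge_def)
  have F_meas: "F \<in> borel_measurable (Pi\<^sub>M J M)"
    unfolding F_def
    by (rule measurable_compose[OF _ f], rule measurable_compose[OF _ measurable_merge])
       (use y0 in measurable)
  have G_meas: "G \<in> borel_measurable (Pi\<^sub>M K M)"
    unfolding G_def
    by (rule measurable_compose[OF _ g], rule measurable_compose[OF _ measurable_merge])
       (use x0 in measurable)
  note fold = product_nn_integral_fold[OF disj fin]
  have "(\<integral>\<^sup>+ x. f x * g x \<partial>Pi\<^sub>M (J \<union> K) M) =
        (\<integral>\<^sup>+ x. \<integral>\<^sup>+ y. F x * G y \<partial>Pi\<^sub>M K M \<partial>Pi\<^sub>M J M)"
    using f g by (subst fold) (auto simp: F G)
  also have "\<dots> = (\<integral>\<^sup>+ x. F x \<partial>Pi\<^sub>M J M) * (\<integral>\<^sup>+ y. G y \<partial>Pi\<^sub>M K M)"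
    using F_meas G_meas by (simp add: nn_integral_cmult nn_integral_multc)
  also have "(\<integral>\<^sup>+ x. F x \<partial>Pi\<^sub>M J M) = (\<integral>\<^sup>+ x. f x \<partial>Pi\<^sub>M (J \<union> K) M)"
    using f by (subst fold) (auto simp: F K.emeasure_space_1)
  also have "(\<integral>\<^sup>+ y. G y \<partial>Pi\<^sub>M K M) = (\<integral>\<^sup>+ x. g x \<partial>Pi\<^sub>M (J \<union> K) M)"
    using g by (subst fold) (auto simp: G J.emeasure_space_1)
  finally show ?thesis .
qed

lemma ennreal_half: "(1 / 2 :: ennreal) = ennreal (1 / 2)"
  by (simp add: divide_ennreal flip: ennreal_1 ennreal_numeral)

lemma ennreal_half_add_half: "1 / 2 + 1 / 2 = (1 :: ennreal)"
  unfolding ennreal_half by (subst ennreal_plus[symmetric]) auto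

section \<open>Partial maxima and truncation at a level\<close>

text \<open>A variable is dropped by shrinking \<open>K\<close>, not by setting it to 0. The value
  then visibly depends only on the coordinates in \<open>K\<close>, as the independence arguments
  require.\<close>

definition max_partial :: "nat \<Rightarrow> (nat \<Rightarrow> nat \<Rightarrow> real) \<Rightarrow> nat set \<Rightarrow> (nat \<Rightarrow> real) \<Rightarrow> real" where
  "max_partial n A K z = (MAX i\<in>{..<n}. \<Sum>j\<in>K. A i j * z j)"

text \<open>
  Values outside \<open>[0, t)\<close> are sent to 0, negative ones included, so that \<open>low_part\<close> is nonnegative
  everywhere and not merely almost everywhere.
\<close>
definition low_part :: "real \<Rightarrow> (nat \<Rightarrow> real) \<Rightarrow> nat \<Rightarrow> real" where
  "low_part t y j = (if 0 \<le> y j \<and> y j < t then y j else 0)"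

definition high_part :: "real \<Rightarrow> (nat \<Rightarrow> real) \<Rightarrow> nat \<Rightarrow> real" where
  "high_part t y j = (if t \<le> y j then y j else 0)"

lemma max_partial_cong:
  "(\<And>j. j \<in> K \<Longrightarrow> z j = z' j) \<Longrightarrow> max_partial n A K z = max_partial n A K z'"
  unfolding max_partial_def by (simp cong: sum.cong)

lemma max_partial_ge: "i < n \<Longrightarrow> (\<Sum>j\<in>K. A i j * z j) \<le> max_partial n A K z"
  unfolding max_partial_def by (rule Max_ge) auto

lemma max_partial_le_iff:
  "0 < n \<Longrightarrow> max_partial n A K z \<le> c \<longleftrightarrow> (\<forall>i<n. (\<Sum>j\<in>K. A i j * z j) \<le> c)"
  unfolding max_partial_def by (subst Max_le_iff) auto

lemma max_partial_less_iff:
  "0 < n \<Longrightarrow> max_partial n A K z < c \<longleftrightarrow> (\<forall>i<n. (\<Sum>j\<in>K. A i j * z j) < c)"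
  unfolding max_partial_def by (subst Max_less_iff) auto

lemma expected_max_eq:
  "expected_max n m A D = (\<integral>\<^sup>+ y. ennreal (max_partial n A {..<m} y) \<partial>Pi\<^sub>M {..<m} D)"
  by (simp add: expected_max_def max_partial_def prophet_value_def)

section \<open>The setting with 0/1 entries\<close>

locale binary_prophet = product_prob_space D "{..<m}"
    for D :: "nat \<Rightarrow> real measure" and m :: nat +
  fixes n :: nat and A :: "nat \<Rightarrow> nat \<Rightarrow> real"
  assumes n_pos: "0 < n"
    and sets_D: "sets (D j) = sets borel"
    and AE_D: "AE y in D j. 0 \<le> y"
    and A_binary: "i < n \<Longrightarrow> j < m \<Longrightarrow> A i j \<in> {0, 1}"
begin

abbreviation P :: "(nat \<Rightarrow> real) measure" where "P \<equiv> Pi\<^sub>M {..<m} D"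

abbreviation mx :: "nat set \<Rightarrow> (nat \<Rightarrow> real) \<Rightarrow> real" where "mx \<equiv> max_partial n A"

text \<open>A zero column never affects the reward. Counting its large values in \<open>tail\<close>
  would break the bound of the expected reward by \<open>below t * tail t\<close>.\<close>

definition used :: "nat set" where "used = {j. j < m \<and> (\<exists>i<n. A i j = 1)}"

text \<open>This is the probability \<open>q\<close> of the overview, and \<open>tail\<close> below
  is its \<open>B\<close>; both live in \<open>ennreal\<close>, since \<open>B\<close> may be
  infinite.\<close>

definition below :: "real \<Rightarrow> ennreal" where
  "below t = (\<integral>\<^sup>+ y. of_bool (mx {..<m} y < t) \<partial>P)"

definition tail :: "real \<Rightarrow> ennreal" where
  "tail t = (\<Sum>j\<in>used. \<integral>\<^sup>+ y. ennreal (high_part t y j) \<partial>P)"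

lemma sets_P: "sets P = sets (Pi\<^sub>M {..<m} (\<lambda>_. borel))"
  by (intro sets_PiM_cong) (auto simp: sets_D)

lemma measurable_component [measurable]: "j < m \<Longrightarrow> (\<lambda>y. y j) \<in> borel_measurable P"
  using measurable_component_singleton[of j "{..<m}" "\<lambda>_. borel :: real measure"]
  by (simp cong: measurable_cong_sets add: sets_P)

lemma measurable_low_part [measurable]: "j < m \<Longrightarrow> (\<lambda>y. low_part t y j) \<in> borel_measurable P"
  unfolding low_part_def by measurable

lemma measurable_high_part [measurable]: "j < m \<Longrightarrow> (\<lambda>y. high_part t y j) \<in> borel_measurable P"
  unfolding high_part_def by measurable

lemma measurable_mx:
  assumes "K \<subseteq> {..<m}" and "\<And>j. j < m \<Longrightarrow> (\<lambda>y. z y j) \<in> borel_measurable P"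
  shows "(\<lambda>y. mx K (z y)) \<in> borel_measurable P"
  unfolding max_partial_def using n_pos assms
  by (intro borel_measurable_Max borel_measurable_sum borel_measurable_times) auto

lemma AE_P_nonneg: "AE y in P. \<forall>j<m. 0 \<le> y j"
proof -
  have "AE y in P. \<forall>j\<in>{..<m}. 0 \<le> y j"
    using AE_D by (intro AE_finite_allI AE_component) (auto simp: M.prob_space_axioms)
  then show ?thesis by (simp add: Ball_def)
qed

lemma used_less: "j \<in> used \<Longrightarrow> j < m" by (simp add: used_def)

lemma finite_used: "finite used" by (simp add: used_def)

lemma A_nonneg: "i < n \<Longrightarrow> j < m \<Longrightarrow> 0 \<le> A i j"
  and A_le_1: "i < n \<Longrightarrow> j < m \<Longrightarrow> A i j \<le> 1"
  using A_binary[of i j] by auto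

lemma mx_nonneg:
  assumes "K \<subseteq> {..<m}" "\<And>j. j \<in> K \<Longrightarrow> 0 \<le> z j"
  shows "0 \<le> mx K z"
proof -
  have "0 \<le> (\<Sum>j\<in>K. A 0 j * z j)"
    using assms n_pos by (intro sum_nonneg mult_nonneg_nonneg A_nonneg) auto
  also have "\<dots> \<le> mx K z" using n_pos by (rule max_partial_ge)
  finally show ?thesis .
qed

lemma mx_mono:
  assumes "K \<subseteq> L" "L \<subseteq> {..<m}" "\<And>j. j \<in> L \<Longrightarrow> 0 \<le> z' j"
    and "\<And>j. j \<in> K \<Longrightarrow> z j \<le> z' j"
  shows "mx K z \<le> mx L z'"
proof -
  have "(\<Sum>j\<in>K. A i j * z j) \<le> mx L z'" if i: "i < n" for i
  proof -
    have "(\<Sum>j\<in>K. A i j * z j) \<le> (\<Sum>j\<in>K. A i j * z' j)"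
      using assms i by (intro sum_mono mult_left_mono A_nonneg) auto
    also have "\<dots> \<le> (\<Sum>j\<in>L. A i j * z' j)"
      using assms i by (intro sum_mono2 mult_nonneg_nonneg A_nonneg) (auto intro: finite_subset)
    also have "\<dots> \<le> mx L z'" using i by (rule max_partial_ge)
    finally show ?thesis .
  qed
  then show ?thesis using n_pos by (simp add: max_partial_le_iff)
qed

lemma mx_union:
  assumes "K \<inter> L = {}" "finite K" "finite L"
  shows "mx (K \<union> L) z \<le> mx K z + mx L z"
  using assms n_pos
  by (auto simp: max_partial_le_iff sum.union_disjoint intro!: add_mono max_partial_ge)

lemma mx_singleton:
  assumes "j < m" "0 \<le> z j"
  shows "mx {j} z \<le> z j"
  using assms n_pos A_le_1 by (auto simp: max_partial_le_iff intro!: mult_left_le_one_le A_nonneg)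

section \<open>Two lower bounds on the reward\<close>

text \<open>At most one summand is nonzero, and it is then the value \<open>y j\<close>. The row at
  which the algorithm stops cannot reach \<open>t\<close> without column \<open>j\<close>; as a
  nonzero entry equals 1, that row collects all of \<open>y j\<close>.\<close>

lemma threshold_reward_ge_sum:
  assumes t: "0 < t" and y: "\<forall>j<m. 0 \<le> y j"
  shows "(\<Sum>j\<in>used. high_part t y j * of_bool (mx ({..<m} - {j}) y < t))
         \<le> threshold_reward n t (prophet_value m A y)" (is "?S \<le> ?R")
proof (cases "\<exists>j\<in>used. t \<le> y j \<and> mx ({..<m} - {j}) y < t")
  case True
  then obtain j where j: "j \<in> used" "t \<le> y j" "mx ({..<m} - {j}) y < t" by blast
  \<comment> \<open>A second large used variable \<open>k\<close> would lift a row containing it to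
    \<open>t\<close> even without \<open>j\<close>.\<close>
  have other: "high_part t y k * of_bool (mx ({..<m} - {k}) y < t) = 0"
    if k: "k \<in> used - {j}" for k
  proof (rule ccontr)
    assume "\<not> ?thesis"
    then have kt: "t \<le> y k" by (auto simp: high_part_def split: if_splits)
    obtain i where i: "i < n" "A i k = 1" using k by (auto simp: used_def)
    have "y k = (\<Sum>l\<in>{k}. A i l * y l)" using i by simp
    also have "\<dots> \<le> mx {k} y" using i by (intro max_partial_ge)
    also have "\<dots> \<le> mx ({..<m} - {j}) y"
      using k y used_less by (intro mx_mono) auto
    finally show False using j kt by simp
  qed
  have split: "prophet_value m A y i = A i j * y j + (\<Sum>l\<in>{..<m} - {j}. A i l * y l)" for i
    unfolding prophet_value_def using used_less[OF j(1)] by (subst sum.remove[of _ j]) auto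
  have rest_nonneg: "0 \<le> (\<Sum>l\<in>{..<m} - {j}. A i l * y l)" if "i < n" for i
    using that y by (intro sum_nonneg mult_nonneg_nonneg A_nonneg) auto
  have rest_less: "(\<Sum>l\<in>{..<m} - {j}. A i l * y l) < t" if "i < n" for i
    using j(3) that n_pos by (simp add: max_partial_less_iff)
  have ex: "\<exists>i. i < n \<and> t \<le> prophet_value m A y i"
  proof -
    obtain i where i: "i < n" "A i j = 1" using j by (auto simp: used_def)
    then show ?thesis using split[of i] rest_nonneg[of i] j by auto
  qed
  define l where "l = (LEAST i. i < n \<and> t \<le> prophet_value m A y i)"
  have l: "l < n" "t \<le> prophet_value m A y l"
    using LeastI_ex[OF ex] by (auto simp: l_def)
  \<comment> \<open>The rest of row \<open>l\<close> is below \<open>t\<close>, so the entry cannot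
    be 0, and the only alternative is 1.\<close>
  have "A l j = 1"
    using A_binary[OF l(1) used_less[OF j(1)]] split[of l] rest_less[OF l(1)] l(2) by auto
  then have "y j \<le> ?R"
    using ex split[of l] rest_nonneg[OF l(1)] by (auto simp: threshold_reward_def l_def)
  moreover have "?S = y j"
    using j finite_used sum.neutral[OF ballI[OF other], of "used - {j}"]
    by (subst sum.remove[of _ j]) (simp_all add: high_part_def)
  ultimately show ?thesis by simp
next
  case False
  then have "?S = 0" by (intro sum.neutral) (auto simp: high_part_def)
  moreover have "0 \<le> ?R"
  proof (cases "\<exists>i. i < n \<and> t \<le> prophet_value m A y i")
    case True
    from LeastI_ex[OF this] show ?thesis using True t by (simp add: threshold_reward_def)
  qed (auto simp: threshold_reward_def)
  ultimately show ?thesis by simp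
qed

text \<open>In each summand the event concerns only the variables other than \<open>j\<close>, so it
  is independent of \<open>high_part t y j\<close>. Its probability is at least
  \<open>below t\<close>, because omitting a nonnegative variable can only lower the
  maximum.\<close>

lemma expected_alg_ge_tail:
  assumes t: "0 < t"
  shows "below t * tail t \<le> expected_alg n m A D t"
proof -
  have [measurable]: "(\<lambda>y. mx ({..<m} - {j}) y) \<in> borel_measurable P" for j
    by (intro measurable_mx) auto
  have [measurable]: "j \<in> used \<Longrightarrow> (\<lambda>y. high_part t y j) \<in> borel_measurable P" for j
    using used_less by auto
  have summand: "(\<integral>\<^sup>+ y. ennreal (high_part t y j) \<partial>P) * below t \<le>
      (\<integral>\<^sup>+ y. ennreal (high_part t y j) * of_bool (mx ({..<m} - {j}) y < t) \<partial>P)"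
    if j: "j \<in> used" for j
  proof -
    have Un: "{j} \<union> ({..<m} - {j}) = {..<m}" using used_less[OF j] by auto
    have "below t \<le> (\<integral>\<^sup>+ y. of_bool (mx ({..<m} - {j}) y < t) \<partial>P)"
      unfolding below_def
    proof (rule nn_integral_mono_AE, use AE_P_nonneg in eventually_elim)
      fix y :: "nat \<Rightarrow> real" assume "\<forall>j<m. 0 \<le> y j"
      then have "mx ({..<m} - {j}) y \<le> mx {..<m} y" by (intro mx_mono) auto
      then show "(of_bool (mx {..<m} y < t) :: ennreal) \<le> of_bool (mx ({..<m} - {j}) y < t)"
        by auto
    qed
    then have "(\<integral>\<^sup>+ y. ennreal (high_part t y j) \<partial>P) * below t \<le>
      (\<integral>\<^sup>+ y. ennreal (high_part t y j) \<partial>P) * (\<integral>\<^sup>+ y. of_bool (mx ({..<m} - {j}) y < t) \<partial>P)"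
      by (rule mult_left_mono) simp
    also have "\<dots> = (\<integral>\<^sup>+ y. ennreal (high_part t y j) * of_bool (mx ({..<m} - {j}) y < t) \<partial>P)"
    proof (rule nn_integral_PiM_mult_indep[of "{j}" "{..<m} - {j}", unfolded Un, symmetric])
      show "ennreal (high_part t x j) = ennreal (high_part t y j)"
        if "\<And>i. i \<in> {j} \<Longrightarrow> x i = y i" for x y
        using that by (simp add: high_part_def)
      show "(of_bool (mx ({..<m} - {j}) x < t) :: ennreal) = of_bool (mx ({..<m} - {j}) y < t)"
        if "\<And>i. i \<in> {..<m} - {j} \<Longrightarrow> x i = y i" for x y
        using that
        by (subst max_partial_cong[of "{..<m} - {j}" x y]) auto
    qed (use j in auto)
    finally show ?thesis .
  qed
  have "below t * tail t = (\<Sum>j\<in>used. (\<integral>\<^sup>+ y. ennreal (high_part t y j) \<partial>P) * below t)"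
    by (simp add: tail_def sum_distrib_left mult.commute)
  also have "\<dots> \<le> (\<Sum>j\<in>used. \<integral>\<^sup>+ y. ennreal (high_part t y j) * of_bool (mx ({..<m} - {j}) y < t) \<partial>P)"
    by (intro sum_mono summand)
  also have "\<dots> = (\<integral>\<^sup>+ y. (\<Sum>j\<in>used. ennreal (high_part t y j) * of_bool (mx ({..<m} - {j}) y < t)) \<partial>P)"
    by (subst nn_integral_sum) auto
  also have "\<dots> \<le> expected_alg n m A D t"
    unfolding expected_alg_def
  proof (rule nn_integral_mono_AE, use AE_P_nonneg in eventually_elim)
    fix y :: "nat \<Rightarrow> real" assume y: "\<forall>j<m. 0 \<le> y j"
    have nn: "0 \<le> high_part t y j" for j using t by (simp add: high_part_def)
    have "(\<Sum>j\<in>used. ennreal (high_part t y j) * of_bool (mx ({..<m} - {j}) y < t)) =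
          (\<Sum>j\<in>used. ennreal (high_part t y j * of_bool (mx ({..<m} - {j}) y < t)))"
      by (intro sum.cong) auto
    also have "\<dots> = ennreal (\<Sum>j\<in>used. high_part t y j * of_bool (mx ({..<m} - {j}) y < t))"
      using nn by (intro sum_ennreal) simp
    also have "\<dots> \<le> ennreal (threshold_reward n t (prophet_value m A y))"
      by (intro ennreal_leI threshold_reward_ge_sum t y)
    finally show "(\<Sum>j\<in>used. ennreal (high_part t y j) * of_bool (mx ({..<m} - {j}) y < t)) \<le>
      ennreal (threshold_reward n t (prophet_value m A y))" .
  qed
  finally show ?thesis .
qed

text \<open>The complement rule, kept additive to avoid truncated subtraction in
  \<open>ennreal\<close>.\<close>

lemma below_plus_above: "below t + (\<integral>\<^sup>+ y. of_bool (t \<le> mx {..<m} y) \<partial>P) = 1"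
proof -
  have [measurable]: "(\<lambda>y. mx {..<m} y) \<in> borel_measurable P"
    by (intro measurable_mx) auto
  have "below t + (\<integral>\<^sup>+ y. of_bool (t \<le> mx {..<m} y) \<partial>P) =
    (\<integral>\<^sup>+ y. of_bool (mx {..<m} y < t) + of_bool (t \<le> mx {..<m} y) \<partial>P)"
    unfolding below_def by (subst nn_integral_add) auto
  also have "\<dots> = (\<integral>\<^sup>+ y. 1 \<partial>P)" by (intro nn_integral_cong) auto
  finally show ?thesis by (simp add: P.emeasure_space_1)
qed

lemma expected_alg_ge_threshold:
  assumes t: "0 < t"
  shows "ennreal t * (\<integral>\<^sup>+ y. of_bool (t \<le> mx {..<m} y) \<partial>P) \<le> expected_alg n m A D t"
proof -
  have [measurable]: "(\<lambda>y. mx {..<m} y) \<in> borel_measurable P"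
    by (intro measurable_mx) auto
  have "ennreal t * of_bool (t \<le> mx {..<m} y) \<le> ennreal (threshold_reward n t (prophet_value m A y))"
    for y
  proof (cases "t \<le> mx {..<m} y")
    case True
    then have ex: "\<exists>i. i < n \<and> t \<le> prophet_value m A y i"
      using max_partial_less_iff[OF n_pos, of A "{..<m}" y t]
      by (auto simp: prophet_value_def not_less)
    from LeastI_ex[OF this] show ?thesis
      using ex True by (auto simp: threshold_reward_def intro!: ennreal_leI)
  qed simp
  then have "(\<integral>\<^sup>+ y. ennreal t * of_bool (t \<le> mx {..<m} y) \<partial>P) \<le> expected_alg n m A D t"
    unfolding expected_alg_def by (intro nn_integral_mono)
  then show ?thesis by (simp add: nn_integral_cmult)
qed

section \<open>The mean of the truncated maximum\<close>

text \<open>Split at the variable \<open>j\<close> with which the prefix maximum first reaches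
  \<open>t\<close>. The prefix before it contributes less than \<open>t\<close>, the variable itself
  at most \<open>t\<close>, and the rest at most its own maximum. The crossing indicator depends on
  indices up to \<open>j\<close> only, the remaining factor on later ones.\<close>

lemma mx_low_part_le:
  assumes t: "0 < t"
  shows "mx {..<m} (low_part t y) \<le> 2 * t +
    (\<Sum>j<m. of_bool (mx {..<j} (low_part t y) < t \<and> t \<le> mx {..<Suc j} (low_part t y)) *
            mx {Suc j..<m} (low_part t y))" (is "_ \<le> _ + (\<Sum>j<m. ?c j * ?r j)")
proof -
  let ?z = "low_part t y"
  have z: "0 \<le> ?z j" "?z j \<le> t" for j using t by (auto simp: low_part_def)
  have nonneg: "0 \<le> ?c j * ?r j" for j
    by (intro mult_nonneg_nonneg mx_nonneg) (auto simp: z)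
  show ?thesis
  proof (cases "mx {..<m} ?z < t")
    case True
    moreover have "0 \<le> (\<Sum>j<m. ?c j * ?r j)" by (intro sum_nonneg nonneg)
    ultimately show ?thesis using t by linarith
  next
    case False
    define l where "l = (LEAST l. t \<le> mx {..<l} ?z)"
    have l: "t \<le> mx {..<l} ?z"
      using LeastI[of "\<lambda>l. t \<le> mx {..<l} ?z" m] False unfolding l_def by (simp add: not_less)
    have lm: "l \<le> m"
      using Least_le[of "\<lambda>l. t \<le> mx {..<l} ?z" m] False unfolding l_def by (simp add: not_less)
    have less: "mx {..<k} ?z < t" if "k < l" for k
      using not_less_Least[of k "\<lambda>l. t \<le> mx {..<l} ?z"] that by (auto simp: l_def)
    have "mx {..<0} ?z < t" using t n_pos by (simp add: max_partial_less_iff)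
    then have "l \<noteq> 0" using l by (intro notI) simp
    then obtain j where j: "l = Suc j" by (auto simp: gr0_conv_Suc)
    have "{..<m} = ({..<j} \<union> {j}) \<union> {Suc j..<m}" using lm j by auto
    then have "mx {..<m} ?z = mx (({..<j} \<union> {j}) \<union> {Suc j..<m}) ?z" by (rule arg_cong)
    also have "\<dots> \<le> mx ({..<j} \<union> {j}) ?z + ?r j"
      by (intro mx_union) auto
    also have "mx ({..<j} \<union> {j}) ?z \<le> mx {..<j} ?z + mx {j} ?z"
      by (intro mx_union) auto
    also have "mx {..<j} ?z \<le> t" using less[of j] j by simp
    also have "mx {j} ?z \<le> t"
      using mx_singleton[of j ?z] z[of j] lm j by auto
    also have "?r j = ?c j * ?r j" using less[of j] l j by simp
    also have "?c j * ?r j \<le> (\<Sum>j<m. ?c j * ?r j)"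
      using lm j by (intro member_le_sum nonneg) auto
    finally show ?thesis by simp
  qed
qed

text \<open>Prefix maxima are monotone, so each crossing indicator is an increment of
  \<open>?h\<close>, and the increments telescope.\<close>

lemma sum_crossing_le:
  assumes t: "0 < t"
  shows "(\<Sum>j<m. of_bool (mx {..<j} (low_part t y) < t \<and> t \<le> mx {..<Suc j} (low_part t y)))
    \<le> (of_bool (t \<le> mx {..<m} (low_part t y)) :: real)"
proof -
  let ?z = "low_part t y"
  let ?h = "\<lambda>j. of_bool (t \<le> mx {..<j} ?z) :: real"
  have mono: "mx {..<j} ?z \<le> mx {..<Suc j} ?z" if "j < m" for j
    using that by (intro mx_mono) (auto simp: low_part_def)
  have "(\<Sum>j<m. of_bool (mx {..<j} ?z < t \<and> t \<le> mx {..<Suc j} ?z)) = (\<Sum>j<m. ?h (Suc j) - ?h j)"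
    using mono by (intro sum.cong) (force simp: not_le)+
  also have "\<dots> \<le> ?h m" by (subst sum_lessThan_telescope) simp
  finally show ?thesis .
qed

text \<open>Integrating the pathwise bound and using independence of the crossing from later
  variables gives \<open>?E\<close> at most \<open>2 * t\<close> plus half of \<open>?E\<close>,
  which is then solved for \<open>?E\<close>.\<close>

lemma expected_low_le:
  assumes t: "0 < t" and q: "1 / 2 \<le> below t"
  shows "(\<integral>\<^sup>+ y. ennreal (mx {..<m} (low_part t y)) \<partial>P) \<le> ennreal (4 * t)" (is "?E \<le> _")
proof -
  let ?c = "\<lambda>j y. of_bool (mx {..<j} (low_part t y) < t \<and> t \<le> mx {..<Suc j} (low_part t y))"
  let ?r = "\<lambda>j y. mx {Suc j..<m} (low_part t y)"
  have [measurable]: "(\<lambda>y. mx K (low_part t y)) \<in> borel_measurable P" if "K \<subseteq> {..<m}" for K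
    using that by (intro measurable_mx measurable_low_part)
  have [measurable]: "(\<lambda>y. mx {..<m} y) \<in> borel_measurable P"
    by (intro measurable_mx) auto
  have z: "0 \<le> low_part t y j" "low_part t y j \<le> t" for y j using t by (auto simp: low_part_def)
  have low_cong: "low_part t x j = low_part t y j" if "x j = y j" for x y j
    using that by (simp add: low_part_def)
  have r: "0 \<le> ?r j y" for j y by (intro mx_nonneg) (auto simp: z)
  have c_meas [measurable]: "(\<lambda>y. ?c j y :: ennreal) \<in> borel_measurable P" if "j < m" for j
  proof -
    have [measurable]: "(\<lambda>y. mx {..<j} (low_part t y)) \<in> borel_measurable P"
      "(\<lambda>y. mx {..<Suc j} (low_part t y)) \<in> borel_measurable P"
      using that by (auto intro!: measurable_mx measurable_low_part)
    show ?thesis by measurable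
  qed
  have r_meas [measurable]: "(\<lambda>y. ?r j y) \<in> borel_measurable P" for j
    by (intro measurable_mx measurable_low_part) auto
  \<comment> \<open>Finiteness allows half of \<open>?E\<close> to be absorbed at the end;
    truncation supplies the crude bound of \<open>m\<close> times \<open>t\<close>.\<close>
  have fin: "?E < \<top>"
  proof -
    have "mx {..<m} (low_part t y) \<le> (\<Sum>j<m. t)" for y
    proof -
      have "(\<Sum>j<m. A i j * low_part t y j) \<le> (\<Sum>j<m. t)" if "i < n" for i
      proof (rule sum_mono)
        fix j assume "j \<in> {..<m}"
        then have "A i j * low_part t y j \<le> 1 * t"
          using z[of y j] that t by (intro mult_mono A_le_1) auto
        then show "A i j * low_part t y j \<le> t" by simp
      qed
      then show ?thesis using n_pos by (simp only: max_partial_le_iff) simp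
    qed
    then have "?E \<le> (\<integral>\<^sup>+ y. ennreal (\<Sum>j<m. t) \<partial>P)"
      by (intro nn_integral_mono ennreal_leI)
    also have "\<dots> < \<top>" by (simp add: P.emeasure_space_1)
    finally show ?thesis .
  qed
  have indep: "(\<integral>\<^sup>+ y. ?c j y * ennreal (?r j y) \<partial>P) \<le> (\<integral>\<^sup>+ y. ?c j y \<partial>P) * ?E" if j: "j < m" for j
  proof -
    have Un: "{..<Suc j} \<union> {Suc j..<m} = {..<m}" using j by auto
    have "(\<integral>\<^sup>+ y. ?c j y * ennreal (?r j y) \<partial>P) =
          (\<integral>\<^sup>+ y. ?c j y \<partial>P) * (\<integral>\<^sup>+ y. ennreal (?r j y) \<partial>P)"
    proof (rule nn_integral_PiM_mult_indep[of "{..<Suc j}" "{Suc j..<m}", unfolded Un])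
      show "?c j x = ?c j y" if "\<And>i. i \<in> {..<Suc j} \<Longrightarrow> x i = y i" for x y
      proof -
        have "mx {..<j} (low_part t x) = mx {..<j} (low_part t y)"
          "mx {..<Suc j} (low_part t x) = mx {..<Suc j} (low_part t y)"
          using that by (auto intro!: max_partial_cong low_cong)
        then show ?thesis by simp
      qed
      show "ennreal (?r j x) = ennreal (?r j y)" if "\<And>i. i \<in> {Suc j..<m} \<Longrightarrow> x i = y i" for x y
        using that by (auto intro!: arg_cong[of _ _ ennreal] max_partial_cong low_cong)
    qed (use j in auto)
    also have "(\<integral>\<^sup>+ y. ennreal (?r j y) \<partial>P) \<le> ?E"
      by (intro nn_integral_mono ennreal_leI mx_mono) (auto simp: z)
    finally show ?thesis by (simp add: mult_left_mono)
  qed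
  \<comment> \<open>A crossing of the truncated maximum forces the full maximum to reach
    \<open>t\<close>, an event of probability at most 1/2 by \<open>q\<close>.\<close>
  have prob: "(\<Sum>j<m. \<integral>\<^sup>+ y. ?c j y \<partial>P) \<le> 1 / 2"
  proof -
    have "(\<Sum>j<m. \<integral>\<^sup>+ y. ?c j y \<partial>P) = (\<integral>\<^sup>+ y. (\<Sum>j<m. ?c j y) \<partial>P)"
      by (subst nn_integral_sum) auto
    also have "\<dots> \<le> (\<integral>\<^sup>+ y. of_bool (t \<le> mx {..<m} y) \<partial>P)"
    proof (rule nn_integral_mono_AE, use AE_P_nonneg in eventually_elim)
      fix y :: "nat \<Rightarrow> real" assume y: "\<forall>j<m. 0 \<le> y j"
      have "(\<Sum>j<m. ?c j y) = (\<Sum>j<m. ennreal (?c j y))" by (intro sum.cong) auto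
      also have "\<dots> = ennreal (\<Sum>j<m. ?c j y)" by (intro sum_ennreal) simp
      also have "\<dots> \<le> ennreal (of_bool (t \<le> mx {..<m} (low_part t y)))"
        by (intro ennreal_leI sum_crossing_le t)
      also have "\<dots> \<le> of_bool (t \<le> mx {..<m} y)"
      proof -
        have "mx {..<m} (low_part t y) \<le> mx {..<m} y"
          using y by (intro mx_mono) (auto simp: low_part_def)
        then show ?thesis by auto
      qed
      finally show "(\<Sum>j<m. ?c j y :: ennreal) \<le> of_bool (t \<le> mx {..<m} y)" .
    qed
    finally have le: "(\<Sum>j<m. \<integral>\<^sup>+ y. ?c j y \<partial>P) \<le> (\<integral>\<^sup>+ y. of_bool (t \<le> mx {..<m} y) \<partial>P)" (is "_ \<le> ?u") .
    have "1 / 2 + ?u \<le> 1 / 2 + 1 / 2"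
      using below_plus_above[of t] q add_right_mono[OF q, of ?u]
      by (simp only: ennreal_half_add_half)
    then have "?u \<le> 1 / 2" by (subst (asm) ennreal_add_left_cancel_le) auto
    with le show ?thesis by simp
  qed
  have "?E \<le> (\<integral>\<^sup>+ y. ennreal (2 * t) + (\<Sum>j<m. ?c j y * ennreal (?r j y)) \<partial>P)"
  proof (rule nn_integral_mono)
    fix y :: "nat \<Rightarrow> real"
    have "ennreal (mx {..<m} (low_part t y)) \<le> ennreal (2 * t + (\<Sum>j<m. ?c j y * ?r j y))"
      by (intro ennreal_leI mx_low_part_le t)
    also have "\<dots> = ennreal (2 * t) + ennreal (\<Sum>j<m. ?c j y * ?r j y)"
      using t r by (intro ennreal_plus sum_nonneg) auto
    also have "ennreal (\<Sum>j<m. ?c j y * ?r j y) = (\<Sum>j<m. ennreal (?c j y * ?r j y))"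
      using r by (intro sum_ennreal[symmetric]) simp
    also have "\<dots> = (\<Sum>j<m. ?c j y * ennreal (?r j y))"
      by (intro sum.cong) auto
    finally show "ennreal (mx {..<m} (low_part t y)) \<le> ennreal (2 * t) + (\<Sum>j<m. ?c j y * ennreal (?r j y))" .
  qed
  also have "\<dots> = ennreal (2 * t) + (\<integral>\<^sup>+ y. (\<Sum>j<m. ?c j y * ennreal (?r j y)) \<partial>P)"
    by (subst nn_integral_add)
       (auto simp: P.emeasure_space_1 simp del: sum_of_bool_mult_eq sum_mult_of_bool_eq)
  also have "(\<integral>\<^sup>+ y. (\<Sum>j<m. ?c j y * ennreal (?r j y)) \<partial>P) =
      (\<Sum>j<m. \<integral>\<^sup>+ y. ?c j y * ennreal (?r j y) \<partial>P)"
    by (intro nn_integral_sum borel_measurable_times c_meas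
          measurable_compose[OF r_meas measurable_ennreal]) auto
  also have "\<dots> \<le> (\<Sum>j<m. (\<integral>\<^sup>+ y. ?c j y \<partial>P) * ?E)"
    by (intro sum_mono indep) auto
  also have "\<dots> = (\<Sum>j<m. \<integral>\<^sup>+ y. ?c j y \<partial>P) * ?E"
    by (simp add: sum_distrib_right)
  also have "\<dots> \<le> 1 / 2 * ?E"
    by (intro mult_right_mono prob) auto
  finally have main: "?E \<le> ennreal (2 * t) + 1 / 2 * ?E"
    by (simp add: add_left_mono)
  obtain e where e: "0 \<le> e" "?E = ennreal e" using fin by (cases ?E) auto
  have "ennreal (2 * t) + ennreal (1 / 2) * ennreal e = ennreal (2 * t + 1 / 2 * e)"
    using t e(1) by (subst ennreal_mult[symmetric], simp, simp, subst ennreal_plus) auto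
  then have "ennreal e \<le> ennreal (2 * t + 1 / 2 * e)"
    using main unfolding e(2) ennreal_half by simp
  then have "e \<le> 2 * t + 1 / 2 * e"
    using t e(1) by (subst (asm) ennreal_le_iff) auto
  then show ?thesis unfolding e(2) by (intro ennreal_leI) simp
qed

section \<open>Upper bound on the expected maximum\<close>

text \<open>Every row splits into a low and a high part. Its high part is at most the sum of all
  used high values, a bound common to all rows, so it survives taking the maximum.\<close>

lemma expected_max_le:
  assumes t: "0 < t"
  shows "expected_max n m A D \<le> (\<integral>\<^sup>+ y. ennreal (mx {..<m} (low_part t y)) \<partial>P) + tail t"
proof -
  have [measurable]: "(\<lambda>y. mx {..<m} (low_part t y)) \<in> borel_measurable P"
    by (intro measurable_mx measurable_low_part) auto
  have [measurable]: "j \<in> used \<Longrightarrow> (\<lambda>y. high_part t y j) \<in> borel_measurable P" for j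
    using used_less by auto
  have h: "0 \<le> high_part t y j" for y j using t by (simp add: high_part_def)
  have "expected_max n m A D \<le>
    (\<integral>\<^sup>+ y. ennreal (mx {..<m} (low_part t y)) + (\<Sum>j\<in>used. ennreal (high_part t y j)) \<partial>P)"
    unfolding expected_max_eq
  proof (rule nn_integral_mono_AE, use AE_P_nonneg in eventually_elim)
    fix y :: "nat \<Rightarrow> real" assume y: "\<forall>j<m. 0 \<le> y j"
    have "(\<Sum>j<m. A i j * y j) \<le> mx {..<m} (low_part t y) + (\<Sum>j\<in>used. high_part t y j)"
      if i: "i < n" for i
    proof -
      have "(\<Sum>j<m. A i j * y j) =
            (\<Sum>j<m. A i j * low_part t y j) + (\<Sum>j<m. A i j * high_part t y j)"
        unfolding sum.distrib[symmetric] using y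
        by (intro sum.cong) (auto simp: low_part_def high_part_def)
      also have "(\<Sum>j<m. A i j * low_part t y j) \<le> mx {..<m} (low_part t y)"
        using i by (rule max_partial_ge)
      also have "(\<Sum>j<m. A i j * high_part t y j) = (\<Sum>j\<in>used. A i j * high_part t y j)"
        using A_binary[OF i] i by (intro sum.mono_neutral_right) (auto simp: used_def)
      also have "\<dots> \<le> (\<Sum>j\<in>used. high_part t y j)"
        using A_le_1 A_nonneg i h used_less by (intro sum_mono mult_left_le_one_le) auto
      finally show ?thesis by simp
    qed
    then have "mx {..<m} y \<le> mx {..<m} (low_part t y) + (\<Sum>j\<in>used. high_part t y j)"
      using n_pos by (simp add: max_partial_le_iff)
    then have "ennreal (mx {..<m} y) \<le>
      ennreal (mx {..<m} (low_part t y) + (\<Sum>j\<in>used. high_part t y j))"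
      by (rule ennreal_leI)
    also have "\<dots> = ennreal (mx {..<m} (low_part t y)) + ennreal (\<Sum>j\<in>used. high_part t y j)"
      using h by (intro ennreal_plus mx_nonneg sum_nonneg) (auto simp: low_part_def)
    also have "ennreal (\<Sum>j\<in>used. high_part t y j) = (\<Sum>j\<in>used. ennreal (high_part t y j))"
      using h by (intro sum_ennreal[symmetric])
    finally show "ennreal (mx {..<m} y) \<le>
      ennreal (mx {..<m} (low_part t y)) + (\<Sum>j\<in>used. ennreal (high_part t y j))" .
  qed
  also have "\<dots> = (\<integral>\<^sup>+ y. ennreal (mx {..<m} (low_part t y)) \<partial>P) + tail t"
    unfolding tail_def by (subst nn_integral_add) (auto simp: nn_integral_sum)
  finally show ?thesis .
qed

section \<open>Choice of the threshold\<close>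

text \<open>Serves the case of an infinite mean, where no fraction of it can be the threshold. The
  maximum is real-valued, so each outcome is eventually below \<open>real k\<close>, and dominated
  convergence applies.\<close>

lemma below_tendsto_1: "(\<lambda>k. below (real k)) \<longlonglongrightarrow> 1"
proof -
  have [measurable]: "(\<lambda>y. mx {..<m} y) \<in> borel_measurable P"
    by (intro measurable_mx) auto
  have "(\<lambda>k. \<integral>\<^sup>+ y. of_bool (mx {..<m} y < real k) \<partial>P) \<longlonglongrightarrow> (\<integral>\<^sup>+ y. 1 \<partial>P)"
  proof (rule nn_integral_dominated_convergence[where w = "\<lambda>_. 1"])
    show "AE y in P. (\<lambda>k. of_bool (mx {..<m} y < real k) :: ennreal) \<longlonglongrightarrow> 1"
    proof (intro AE_I2 tendsto_eventually)
      fix y :: "nat \<Rightarrow> real"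
      obtain k0 where k0: "mx {..<m} y < real k0" using reals_Archimedean2 by blast
      show "\<forall>\<^sub>F k in sequentially. (of_bool (mx {..<m} y < real k) :: ennreal) = 1"
        using eventually_ge_at_top[of k0] by eventually_elim (use k0 in auto)
    qed
  qed (auto simp: P.emeasure_space_1)
  then show ?thesis by (simp add: below_def P.emeasure_space_1)
qed

lemma exists_threshold:
  "\<exists>\<tau>. ennreal (1 / 16) * expected_max n m A D \<le> expected_alg n m A D \<tau>"
proof (cases "expected_max n m A D")
  case (real e)
  show ?thesis
  proof (cases "e = 0")
    case True
    then show ?thesis using real by simp
  next
    case False
    \<comment> \<open>With this choice \<open>4 * t\<close> is half of \<open>e\<close>. If
      \<open>below t\<close> is at least 1/2, then \<open>tail t\<close> is at least
      \<open>e / 2\<close> and the reward at least \<open>e / 4\<close>; otherwise the reward is at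
      least \<open>t / 2\<close>, which is \<open>e / 16\<close> and fixes the constant.\<close>
    define t where "t = e / 8"
    have t: "0 < t" using real False by (simp add: t_def)
    let ?u = "\<integral>\<^sup>+ y. of_bool (t \<le> mx {..<m} y) \<partial>P"
    show ?thesis
    proof (cases "1 / 2 \<le> below t")
      case True
      have "ennreal e \<le> ennreal (4 * t) + tail t"
        using order_trans[OF expected_max_le[OF t] add_right_mono[OF expected_low_le[OF t True]]]
        unfolding real(2) .
      moreover have "ennreal e = ennreal (4 * t) + ennreal (e / 2)"
        using real t by (subst ennreal_plus[symmetric]) (auto simp: t_def)
      ultimately have "ennreal (e / 2) \<le> tail t"
        by (simp add: ennreal_add_left_cancel_le)
      have "ennreal (1 / 16) * ennreal e \<le> ennreal (1 / 2) * ennreal (e / 2)"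
        using real by (subst (1 2) ennreal_mult[symmetric]) (auto intro!: ennreal_leI)
      also have "\<dots> \<le> below t * tail t"
        using True \<open>ennreal (e / 2) \<le> tail t\<close> unfolding ennreal_half by (intro mult_mono) auto
      also have "\<dots> \<le> expected_alg n m A D t" by (rule expected_alg_ge_tail[OF t])
      finally show ?thesis using real by auto
    next
      case False
      have "1 / 2 \<le> ?u"
      proof (rule ccontr)
        assume "\<not> ?thesis"
        then have "below t + ?u < 1 / 2 + 1 / 2" using False
          by (intro add_strict_mono) auto
        then show False using below_plus_above[of t]
          by (simp only: ennreal_half_add_half less_irrefl)
      qed
      have "ennreal (1 / 16) * ennreal e = ennreal t * (1 / 2)"
        using real t unfolding ennreal_half t_def by (subst (1 2) ennreal_mult[symmetric]) auto
      also have "\<dots> \<le> ennreal t * ?u" using \<open>1 / 2 \<le> ?u\<close> by (intro mult_left_mono) auto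
      also have "\<dots> \<le> expected_alg n m A D t" by (rule expected_alg_ge_threshold[OF t])
      finally show ?thesis using real by auto
    qed
  qed
next
  case top
  have "(1 / 2 :: ennreal) < 1"
    unfolding ennreal_half by (simp only: ennreal_less_one_iff)
  then have "\<forall>\<^sub>F k in sequentially. 1 / 2 < below (real k)"
    using below_tendsto_1 by (rule order_tendstoD(1)[rotated])
  then obtain k where k: "0 < k" "1 / 2 < below (real k)"
    using eventually_happens'[OF _ eventually_conj[OF eventually_gt_at_top[of "0::nat"]]]
    by (metis (no_types, lifting) sequentially_bot)
  define t where "t = real k"
  have t: "0 < t" "1 / 2 \<le> below t" using k by (auto simp: t_def)
  have "\<top> \<le> ennreal (4 * t) + tail t"
    using order_trans[OF expected_max_le[OF t(1)] add_right_mono[OF expected_low_le[OF t]]]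
    unfolding top .
  then have "tail t = \<top>" by (auto simp: top_unique)
  \<comment> \<open>Needed because 0 times infinity is 0 in \<open>ennreal\<close>.\<close>
  moreover have "below t \<noteq> 0" using t(2) by auto
  ultimately have "below t * tail t = \<top>" by (simp add: ennreal_mult_top)
  then have "expected_alg n m A D t = \<top>"
    using expected_alg_ge_tail[OF t(1)] by (simp add: top_unique)
  then show ?thesis by (intro exI[of _ t]) simp
qed

end

section \<open>Transfer to arbitrary instances\<close>

theorem theorem2p4:
  "\<exists>C::real. C \<ge> 1 \<and>
     (\<forall>(n::nat) (m::nat) (A::nat \<Rightarrow> nat \<Rightarrow> real) (D::nat \<Rightarrow> real measure).
        linear_prophet_instance n m A D \<and> (\<forall>i<n. \<forall>j<m. A i j \<in> {0, 1}) \<longrightarrow>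
        (\<exists>\<tau>::real. expected_alg n m A D \<tau> \<ge> ennreal (1 / C) * expected_max n m A D))"
proof (rule exI[of _ "16::real"], intro conjI allI impI)
  fix n m :: nat and A :: "nat \<Rightarrow> nat \<Rightarrow> real" and D :: "nat \<Rightarrow> real measure"
  assume inst: "linear_prophet_instance n m A D \<and> (\<forall>i<n. \<forall>j<m. A i j \<in> {0, 1})"
  \<comment> \<open>\<open>product_prob_space\<close> wants a probability measure at every index, \<open>D\<close> has one only below \<open>m\<close>\<close>
  define D' where "D' j = (if j < m then D j else return borel 0)" for j
  have prob: "prob_space (D' j)" and sets: "sets (D' j) = sets borel" for j
    using inst by (auto simp: D'_def linear_prophet_instance_def prob_space_return)
  have AE: "AE y in D' j. 0 \<le> y" for j
  proof (cases "j < m")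
    case True
    then have "D' j = D j" by (simp add: D'_def)
    then show ?thesis using inst True unfolding \<open>D' j = D j\<close>
      by (simp add: linear_prophet_instance_def)
  next
    case False
    then have "D' j = return borel 0" by (simp add: D'_def)
    then show ?thesis unfolding \<open>D' j = return borel 0\<close> by (simp add: AE_return)
  qed
  interpret prob_space "D' j" for j by (rule prob)
  interpret binary_prophet D' m n A
    by unfold_locales (use inst sets AE in \<open>auto simp: linear_prophet_instance_def\<close>)
  \<comment> \<open>The padding beyond \<open>m\<close> leaves the product measure, and hence both
    expectations, unchanged.\<close>
  have "Pi\<^sub>M {..<m} D' = Pi\<^sub>M {..<m} D" by (intro PiM_cong) (auto simp: D'_def)
  then show "\<exists>\<tau>. ennreal (1 / 16) * expected_max n m A D \<le> expected_alg n m A D \<tau>"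
    using exists_threshold by (simp add: expected_alg_def expected_max_def)
qed simp

end
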